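(* Let $T$ be a tree of order $n$ with $\operatorname{diam}(T)\geq 3$. Then $$n-\beta(T)\;\leq\;\gamma_{t,coi}(T)\;\leq\; n-|L(T)|.$$
   Context: All graphs are finite, simple and undirected. For a graph $G$, a set $D\subseteq V(G)$ is a total dominating set if every vertex of $G$ (including those in $D$) has at least one neighbor in $D$. A total dominating set $D$ is a total co-independent dominating set if $V(G)\setminus D$ is nonempty and independent (no two of its vertices are adjacent). $\gamma_{t,coi}(G)$ denotes the minimum cardinality of a total co-independent dominating set of $G$. $\beta(G)$ is the independence number (maximum size of an independent set). For a tree $T$, a leaf is a vertex of degree one and $L(T)$ is the set of leaves of $T$. *)

theory Defs
  imports "Graph_Theory.Graph_Theory"
begin

text \<open>Finite simple undirected graphs are the symmetric digraphs of the locale \<^locale>\<open>graph\<close>;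
  adjacency is \<open>u \<rightarrow>\<^bsub>G\<^esub> v\<close>.\<close>

text \<open>In a symmetric digraph every edge \<open>uv\<close> yields the directed cycle \<open>u, v, u\<close>, so
  \<^const>\<open>forest\<close> and \<^const>\<open>tree\<close> do not describe undirected forests and trees.
  The cycles of the underlying undirected graph are exactly the directed cycles of length at least 3.\<close>

definition undirected_tree :: "('a, 'b) pre_digraph \<Rightarrow> bool" where
  "undirected_tree G \<longleftrightarrow>
     graph G \<and> Digraph_Component.connected G \<and>
     \<not> (\<exists>p. pre_digraph.cycle G p \<and> length p \<ge> 3)"

definition diameter :: "('a, 'b) pre_digraph \<Rightarrow> ereal" where
  "diameter G = (SUP u\<in>verts G. SUP v\<in>verts G. wf_digraph.\<mu> G (\<lambda>_. 1) u v)"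

text \<open>Each undirected edge at \<open>v\<close> contributes exactly one outgoing arc, so the degree is the
  out-degree.\<close>

definition leaves :: "('a, 'b) pre_digraph \<Rightarrow> 'a set" where
  "leaves G = {v \<in> verts G. out_degree G v = 1}"

definition independent_set :: "('a, 'b) pre_digraph \<Rightarrow> 'a set \<Rightarrow> bool" where
  "independent_set G S \<longleftrightarrow> S \<subseteq> verts G \<and> (\<forall>u\<in>S. \<forall>v\<in>S. \<not> u \<rightarrow>\<^bsub>G\<^esub> v)"

definition independence_number :: "('a, 'b) pre_digraph \<Rightarrow> nat" where
  "independence_number G = Max (card ` {S. independent_set G S})"

definition total_dominating_set :: "('a, 'b) pre_digraph \<Rightarrow> 'a set \<Rightarrow> bool" where
  "total_dominating_set G D \<longleftrightarrow> D \<subseteq> verts G \<and> (\<forall>v\<in>verts G. \<exists>u\<in>D. v \<rightarrow>\<^bsub>G\<^esub> u)"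

definition total_coindependent_dominating_set :: "('a, 'b) pre_digraph \<Rightarrow> 'a set \<Rightarrow> bool" where
  "total_coindependent_dominating_set G D \<longleftrightarrow>
     total_dominating_set G D \<and> verts G - D \<noteq> {} \<and> independent_set G (verts G - D)"

definition total_coindependent_domination_number :: "('a, 'b) pre_digraph \<Rightarrow> nat" where
  "total_coindependent_domination_number G =
     Min (card ` {D. total_coindependent_dominating_set G D})"

end

theory Submission
  imports Defs
begin

text \<open>The upper bound is witnessed by the set of non-leaves. If all neighbours of some vertex
  \<open>v\<close> were leaves, then \<open>v\<close> and its neighbours would form a connected component, so the tree would
  be a star and have diameter at most 2. Hence every vertex has a non-leaf neighbour, which says
  that the non-leaves are totally dominating and, applied to a leaf, that the leaves are
  independent. A leaf exists at the end of any longest path. For the lower bound, the complement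
  of a total co-independent dominating set is independent.\<close>

context graph
begin

lemma dominates_sym: "u \<rightarrow>\<^bsub>G\<^esub> v \<Longrightarrow> v \<rightarrow>\<^bsub>G\<^esub> u"
  using arcs_ends_symmetric sym_arcs by fast

lemma leaf_neighbour_unique:
  assumes "u \<in> leaves G" "u \<rightarrow>\<^bsub>G\<^esub> v" "u \<rightarrow>\<^bsub>G\<^esub> w"
  shows "v = w"
proof -
  obtain e where "out_arcs G u = {e}"
    using assms(1) by (auto simp: leaves_def out_degree_def card_1_singleton_iff)
  then have "\<And>a. a \<in> arcs G \<Longrightarrow> tail G a = u \<Longrightarrow> a = e"
    by (metis in_out_arcs_conv singletonD)
  then show ?thesis
    \<comment> \<open>\<open>reachableE\<close> eliminates a single adjacency, yielding the arc
      behind it. Both arcs have tail \<open>u\<close>, so both are \<open>e\<close> and their heads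
      agree.\<close>
    using assms(2,3) by (metis reachableE)
qed

text \<open>\<open>Digraph_Component.connected\<close> is strong connectedness of the symmetric
  closure. As \<open>G\<close> is already symmetric, every vertex is reachable from \<open>v\<close>
  in \<open>G\<close> itself, and a walk from \<open>v\<close> never leaves
  \<open>S\<close>.\<close>

lemma connected_closed_set_eq_verts:
  assumes "Digraph_Component.connected G" "v \<in> S" "S \<subseteq> verts G"
    and closed: "\<And>x y. x \<in> S \<Longrightarrow> x \<rightarrow>\<^bsub>G\<^esub> y \<Longrightarrow> y \<in> S"
  shows "S = verts G"
proof
  show "verts G \<subseteq> S"
  proof
    fix w assume "w \<in> verts G"
    then have "v \<rightarrow>\<^sup>*\<^bsub>G\<^esub> w"
      using assms(1-3) reachable_mk_symmetric_eq[OF sym_arcs]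
      by (auto simp: Digraph_Component.connected_def strongly_connected_def)
    then show "w \<in> S"
      by (induct rule: reachable_induct) (use \<open>v \<in> S\<close> closed in auto)
  qed
qed fact

text \<open>\<open>\<mu>\<close> is an infimum of walk costs, so a single walk bounds it. Allowing
  equality with \<open>c\<close> treats the centre of a star like its neighbours: two walks of
  length at most 1, joined at \<open>c\<close>, serve every pair.\<close>

lemma dist_le_2_via_centre:
  assumes "c \<in> verts G" "u = c \<or> u \<rightarrow>\<^bsub>G\<^esub> c" "v = c \<or> c \<rightarrow>\<^bsub>G\<^esub> v"
  shows "\<mu> (\<lambda>_. 1) u v \<le> 2"
proof -
  have short: "\<exists>p. awalk x p y \<and> length p \<le> 1" if "x = y \<or> x \<rightarrow>\<^bsub>G\<^esub> y" "y \<in> verts G" for x y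
    using that(1)
  proof
    assume "x = y"
    then have "awalk x [] y"
      using that(2) by (simp add: awalk_Nil_iff)
    then show ?thesis
      by force
  next
    assume "x \<rightarrow>\<^bsub>G\<^esub> y"
    then obtain e where "e \<in> arcs G" "tail G e = x" "head G e = y"
      by (rule reachableE)
    then have "awalk x [e] y"
      by (auto simp: awalk_Nil_iff awalk_Cons_iff)
    then show ?thesis
      by force
  qed
  have "\<exists>p. awalk u p c \<and> length p \<le> 1" "\<exists>q. awalk c q v \<and> length q \<le> 1"
    using assms adj_in_verts(2)[of c v] short[of u c] short[of c v] by blast+
  then obtain p q where pq: "awalk u p c" "length p \<le> 1" "awalk c q v" "length q \<le> 1"
    by blast
  then have "awalk u (p @ q) v"
    by auto
  then have "\<mu> (\<lambda>_. 1) u v \<le> awalk_cost (\<lambda>_. 1) (p @ q)"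
    by (rule min_cost_le_walk_cost)
  also have "\<dots> \<le> ereal 2"
    using pq by (simp add: awalk_cost_def sum_list_triv)
  finally show ?thesis
    by simp
qed

lemma exists_nonleaf_neighbour:
  assumes conn: "Digraph_Component.connected G" and diam: "diameter G \<ge> 3"
    and v: "v \<in> verts G"
  shows "\<exists>u \<in> verts G - leaves G. v \<rightarrow>\<^bsub>G\<^esub> u"
proof (rule ccontr)
  assume "\<not> ?thesis"
  then have all_leaves: "u \<in> leaves G" if "v \<rightarrow>\<^bsub>G\<^esub> u" for u
    using that adj_in_verts by blast
  have "{v} \<union> {u. v \<rightarrow>\<^bsub>G\<^esub> u} = verts G"
  proof (rule connected_closed_set_eq_verts[OF conn, of v])
    \<comment> \<open>A step from a neighbour of \<open>v\<close> can only lead back to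
      \<open>v\<close>, since that neighbour is a leaf.\<close>
    show "y \<in> {v} \<union> {u. v \<rightarrow>\<^bsub>G\<^esub> u}" if "x \<in> {v} \<union> {u. v \<rightarrow>\<^bsub>G\<^esub> u}" "x \<rightarrow>\<^bsub>G\<^esub> y" for x y
      using that all_leaves leaf_neighbour_unique dominates_sym by blast
  qed (use v adj_in_verts in auto)
  then have "\<mu> (\<lambda>_. 1) x y \<le> 2" if "x \<in> verts G" "y \<in> verts G" for x y
    using that v dominates_sym by (intro dist_le_2_via_centre[of v]) auto
  then have "diameter G \<le> 2"
    unfolding diameter_def by (intro SUP_least)
  with diam have "(3 :: ereal) \<le> 2"
    by (rule order_trans)
  then show False
    by simp
qed

text \<open>The start \<open>u\<close> of a longest path is a leaf: a second arc at \<open>u\<close>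
  would lead either off the path, giving a longer path, or back into it, closing a cycle.\<close>

lemma exists_leaf:
  assumes acyclic: "\<not> (\<exists>p. cycle p \<and> length p \<ge> 3)" and "arcs G \<noteq> {}"
  shows "leaves G \<noteq> {}"
proof -
  let ?P = "\<lambda>n. \<exists>u p v. apath u p v \<and> length p = n"
  obtain a where a: "a \<in> arcs G"
    using assms(2) by blast
  then have "apath (tail G a) [a] (head G a)"
    using no_loops by (auto simp: apath_def awalk_def)
  then have P1: "?P 1"
    by force
  have bound: "\<And>n. ?P n \<Longrightarrow> n \<le> card (verts G)"
    using length_apath by blast
  obtain u p v where p: "apath u p v" "length p = Greatest ?P"
    using GreatestI_nat[of ?P 1 "card (verts G)"] P1 bound by blast
  have longest: "length q \<le> length p" if "apath x q y" for x q y
    unfolding p(2) using that bound by (intro Greatest_le_nat[of ?P _ "card (verts G)"]) blast+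
  \<comment> \<open>The one-arc path forces the longest path to be nonempty, so it has a first arc
    \<open>e\<close>.\<close>
  from longest[OF \<open>apath (tail G a) [a] (head G a)\<close>] obtain e q where eq: "p = e # q"
    by (cases p) auto
  with p(1) have e: "e \<in> arcs G" "tail G e = u" and q: "apath (head G e) q v"
    and u_notin: "u \<notin> set (awalk_verts (head G e) q)"
    by (auto simp: apath_Cons_iff)
  have "out_arcs G u = {e}"
  proof (rule ccontr)
    assume "out_arcs G u \<noteq> {e}"
    moreover have "e \<in> out_arcs G u"
      using e by simp
    ultimately obtain e' where "e' \<in> out_arcs G u" "e' \<noteq> e"
      by blast
    then have e': "e' \<in> arcs G" "tail G e' = u" "e' \<noteq> e"
      by auto
    \<comment> \<open>\<open>f\<close> is the reverse of \<open>e'\<close>: put before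
      \<open>p\<close> it prolongs the path, and put after a part of the path it closes the
      cycle.\<close>
    then obtain f where f: "f \<in> arcs G" "tail G f = head G e'" "head G f = u"
      using sym_arcs by (auto simp: symmetric_conv)
    \<comment> \<open>This makes \<open>r\<close> below nonempty, so that the cycle has length at
      least 3 and is not one edge traversed back and forth.\<close>
    have ne: "head G e' \<noteq> head G e"
      using no_multi_arcs[of e' e] e e' by (auto simp: arc_to_ends_def)
    have "head G e' \<in> set (awalk_verts u p)"
    proof (rule ccontr)
      assume "head G e' \<notin> set (awalk_verts u p)"
      then have "apath (head G e') (f # p) v"
        using f p(1) by (auto simp: apath_Cons_iff)
      from longest[OF this] show False
        by simp
    qed
    moreover have "head G e' \<noteq> u"
      using no_loops e' by metis
    ultimately have "head G e' \<in> set (awalk_verts (head G e) q)"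
      using eq e by auto
    then obtain r s where q_split: "q = r @ s" and r: "awalk (head G e) r (head G e')"
      using awalk_decomp[of "head G e" q v] q unfolding apath_def by blast
    have "distinct (awalk_verts (head G e) r)" "u \<notin> set (awalk_verts (head G e) r)"
      using q u_notin unfolding q_split by (auto simp: apath_def awalk_verts_append)
    moreover have cyc: "awalk u (e # r @ [f]) u"
      using e f r by (auto simp: awalk_Cons_iff awalk_Nil_iff)
    \<comment> \<open>\<open>cycle\<close> asks for distinctness only after the first vertex, so it
      is enough that the vertices of \<open>r\<close> are distinct and avoid the closing
      \<open>u\<close>.\<close>
    moreover have "awalk_verts (head G e) (r @ [f]) = awalk_verts (head G e) r @ [u]"
      using cyc f by (subst awalk_verts_append) (auto simp: awalk_Cons_iff)
    ultimately have "cycle (e # r @ [f])"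
      by (auto simp: cycle_def intro!: exI[of _ u])
    moreover have "r \<noteq> []"
      using r ne by (auto simp: awalk_Nil_iff)
    then have "length (e # r @ [f]) \<ge> 3"
      by (cases r) auto
    ultimately show False
      using acyclic by blast
  qed
  then have "u \<in> leaves G"
    using e by (auto simp: leaves_def out_degree_def)
  then show ?thesis
    by blast
qed

lemma nonleaves_total_coindependent_dominating_set:
  assumes "undirected_tree G" "diameter G \<ge> 3"
  shows "total_coindependent_dominating_set G (verts G - leaves G)"
proof -
  have conn: "Digraph_Component.connected G"
    and acyclic: "\<not> (\<exists>p. cycle p \<and> length p \<ge> 3)"
    using assms(1) by (auto simp: undirected_tree_def)
  note nonleaf = exists_nonleaf_neighbour[OF conn assms(2)]
  have "verts G \<noteq> {}"
    using conn by (auto simp: Digraph_Component.connected_def strongly_connected_def)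
  then have "arcs G \<noteq> {}"
    using nonleaf by (auto simp: arcs_ends_conv)
  then have "leaves G \<noteq> {}"
    by (rule exists_leaf[OF acyclic])
  moreover have "leaves G \<subseteq> verts G"
    by (auto simp: leaves_def)
  \<comment> \<open>The only neighbour of a leaf is the non-leaf provided by
    \<open>nonleaf\<close>.\<close>
  moreover have "\<not> u \<rightarrow>\<^bsub>G\<^esub> v" if "u \<in> leaves G" "v \<in> leaves G" for u v
    using that nonleaf[of u] leaf_neighbour_unique[of u v] \<open>leaves G \<subseteq> verts G\<close> by blast
  ultimately show ?thesis
    using nonleaf
    by (auto simp: total_coindependent_dominating_set_def total_dominating_set_def
        independent_set_def double_diff)
qed

lemma finite_total_coindependent_dominating_sets:
  "finite {D. total_coindependent_dominating_set G D}"
  by (rule finite_subset[of _ "Pow (verts G)"])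
    (auto simp: total_coindependent_dominating_set_def total_dominating_set_def)

lemma total_coindependent_domination_number_le:
  assumes "total_coindependent_dominating_set G D"
  shows "total_coindependent_domination_number G \<le> card D"
  unfolding total_coindependent_domination_number_def
  using assms finite_total_coindependent_dominating_sets by (intro Min_le) auto

lemma card_le_independence_number:
  assumes "independent_set G S"
  shows "card S \<le> independence_number G"
proof -
  have "finite {S. independent_set G S}"
    by (rule finite_subset[of _ "Pow (verts G)"]) (auto simp: independent_set_def)
  then show ?thesis
    unfolding independence_number_def using assms by (intro Max_ge) auto
qed

text \<open>The set \<open>D\<^sub>0\<close> ensures that \<open>Min\<close> ranges over a nonempty
  set and is therefore attained by some \<open>D\<close>, whose complement is an independent
  set.\<close>

lemma card_verts_le_domination_plus_independence:
  assumes "total_coindependent_dominating_set G D\<^sub>0"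
  shows "card (verts G) \<le> total_coindependent_domination_number G + independence_number G"
proof -
  have "total_coindependent_domination_number G
      \<in> card ` {D. total_coindependent_dominating_set G D}"
    unfolding total_coindependent_domination_number_def
    using assms finite_total_coindependent_dominating_sets by (intro Min_in) auto
  then obtain D where D: "total_coindependent_dominating_set G D"
    and card_D: "card D = total_coindependent_domination_number G"
    by auto
  have "D \<subseteq> verts G"
    using D by (auto simp: total_coindependent_dominating_set_def total_dominating_set_def)
  then have "card (verts G) = card D + card (verts G - D)"
    by (metis card_Diff_subset card_mono finite_subset finite_verts le_add_diff_inverse)
  moreover have "card (verts G - D) \<le> independence_number G"
    using D by (intro card_le_independence_number)
      (auto simp: total_coindependent_dominating_set_def)
  ultimately show ?thesis
    using card_D by simp
qed

end

theorem theorem1: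
  fixes T :: "('a, 'b) pre_digraph" and n :: nat
  assumes "undirected_tree T"
    and "card (verts T) = n"
    and "diameter T \<ge> 3"
  shows "int n - int (independence_number T) \<le> int (total_coindependent_domination_number T)
       \<and> int (total_coindependent_domination_number T) \<le> int n - int (card (leaves T))"
proof -
  interpret graph T
    using assms(1) by (simp add: undirected_tree_def)
  note nonleaves = nonleaves_total_coindependent_dominating_set[OF assms(1,3)]
  have "leaves T \<subseteq> verts T"
    by (auto simp: leaves_def)
  \<comment> \<open>The second fact makes the truncated subtraction on \<open>nat\<close> agree with
    the one on \<open>int\<close> in the goal.\<close>
  then have "card (verts T - leaves T) = n - card (leaves T)" "card (leaves T) \<le> n"
    using assms(2) by (auto simp: card_Diff_subset finite_subset card_mono)
  then show ?thesis
    using card_verts_le_domination_plus_independence[OF nonleaves]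
      total_coindependent_domination_number_le[OF nonleaves] assms(2)
    by linarith
qed

end
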